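(* Let $\underline{M}\in\mathfrak{M}$. Then the isentrope function $\Psi_{\underline{M}}:(\alpha_1(\underline{M}),\alpha_2(\underline{M}))\to(0,1]$ is differentiable at every point of $(\alpha_1(\underline{M}),\alpha_2(\underline{M}))$, and its derivative $\Psi'_{\underline{M}}$ is continuous on $(\alpha_1(\underline{M}),\alpha_2(\underline{M}))$.
   Context: For $0<\alpha<1$ and $0\le\beta\le1$ the skew tent map $T_{\alpha,\beta}:[0,1]\to[0,1]$ is $T_{\alpha,\beta}(x)=\frac{\beta}{\alpha}x$ for $0\le x\le\alpha$ and $T_{\alpha,\beta}(x)=\frac{\beta}{1-\alpha}(1-x)$ for $\alpha<x\le1$. Let $U=\{(\alpha,\beta): \tfrac12<\beta\le1,\ 1-\beta<\alpha<\beta\}$. For $(\alpha,\beta)\in U$ the extended kneading sequence $(\mathfrak m_1,\mathfrak m_2,\dots)\in\{L,C,R\}^{\mathbb N}$ is defined by $\mathfrak m_n=L$, $C$ or $R$ according as $T^n_{\alpha,\beta}(\alpha)<\alpha$, $=\alpha$ or $>\alpha$. The kneading sequence $K(\alpha,\beta)$ is the extended kneading sequence if it contains no $C$, and otherwise is the finite string obtained by stopping at the first $C$. Let $\mathfrak M=\{K(\alpha,\beta):(\alpha,\beta)\in U\}$. It is known (Misiurewicz–Visinescu) that for each $\underline M\in\mathfrak M$ there exist numbers $\alpha_1(\underline M)<\alpha_2(\underline M)$ and a continuous function $\Psi_{\underline M}$ on $(\alpha_1(\underline M),\alpha_2(\underline M))$ with $(\alpha,\Psi_{\underline M}(\alpha))\in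 U$ such that for $(\alpha,\beta)\in U$ one has $K(\alpha,\beta)=\underline M$ if and only if $\alpha\in(\alpha_1(\underline M),\alpha_2(\underline M))$ and $\beta=\Psi_{\underline M}(\alpha)$. The graph of $\Psi_{\underline M}$ is called the isentrope of $\underline M$. *)

theory Defs
  imports "HOL-Analysis.Analysis"
begin

definition skew_tent :: "real \<Rightarrow> real \<Rightarrow> real \<Rightarrow> real" where
  "skew_tent \<alpha> \<beta> x = (if x \<le> \<alpha> then (\<beta> / \<alpha>) * x else (\<beta> / (1 - \<alpha>)) * (1 - x))"

definition U_region :: "(real \<times> real) set" where
  "U_region = {(\<alpha>, \<beta>). 1/2 < \<beta> \<and> \<beta> \<le> 1 \<and> 1 - \<beta> < \<alpha> \<and> \<alpha> < \<beta>}"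

datatype sym = L | C | R

text \<open>Extended kneading sequence: ext_kneading a b n is the symbol m_n, meaningful for n >= 1.\<close>
definition ext_kneading :: "real \<Rightarrow> real \<Rightarrow> nat \<Rightarrow> sym" where
  "ext_kneading \<alpha> \<beta> n =
     (let y = (skew_tent \<alpha> \<beta> ^^ n) \<alpha> in if y < \<alpha> then L else if y = \<alpha> then C else R)"

datatype kseq = InfSeq "nat \<Rightarrow> sym" | FinSeq "sym list"

definition kneading :: "real \<Rightarrow> real \<Rightarrow> kseq" where
  "kneading \<alpha> \<beta> =
     (if \<forall>n\<ge>1. ext_kneading \<alpha> \<beta> n \<noteq> C
      then InfSeq (\<lambda>i. ext_kneading \<alpha> \<beta> (Suc i))
      else FinSeq (map (ext_kneading \<alpha> \<beta>)
             [1..<Suc (LEAST n. n \<ge> 1 \<and> ext_kneading \<alpha> \<beta> n = C)]))"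

definition kneading_set :: "kseq set" where
  "kneading_set = {kneading \<alpha> \<beta> | \<alpha> \<beta>. (\<alpha>, \<beta>) \<in> U_region}"

end

theory Submission
  imports Defs
begin

text \<open>In the coordinate \<open>(y - \<alpha>) / (\<beta> - \<alpha>)\<close> the orbit of the turning point depends on
  \<open>u = \<alpha> / \<beta>\<close> and \<open>v = (1 - \<alpha>) / \<beta>\<close> only, and on an isentrope these satisfy
  \<open>(\<Sum>n. a n) = 0\<close>, where \<open>a n\<close> is the product of the first \<open>n\<close> inverse slopes along the orbit
  \<open>x\<close> of the turning point, read off the kneading sequence. The \<open>\<beta>\<close>-derivative of the left-hand
  side is \<open>- (\<Sum>n. n * a n) / \<beta>\<close>, so by the implicit function theorem it suffices that
  \<open>(\<Sum>n. n * a n) \<noteq> 0\<close>. Up to sign this sum is the total mass of the explicit piecewise constant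
  invariant density \<open>rho y = (\<Sum>n. a n * of_bool (y < x n))\<close>. As the map is expanding with a single turning point, this density cannot change sign: an interval on which it
  is negative would grow until it meets the turning point, whereas \<open>rho\<close> is positive just below the
  image of the turning point.\<close>

section \<open>Positivity of the invariant density\<close>

text \<open>A nonempty open interval has positive Lebesgue measure. This is how almost-everywhere
  statements are turned back into inequalities between endpoints.\<close>

lemma AE_lborel_interval_empty:
  fixes a b :: real
  assumes "AE x in lborel. \<not> (a < x \<and> x < b)"
  shows "b \<le> a"
proof (rule ccontr)
  assume ab: "\<not> b \<le> a"
  have "{x. \<not> \<not> (a < x \<and> x < b)} = {a<..<b}" by auto
  moreover have "{a<..<b} \<in> sets lborel" by simp
  ultimately have "emeasure lborel {a<..<b} = 0"
    using assms by (subst (asm) AE_iff_measurable[where N = "{a<..<b}"]) auto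
  with ab show False by (simp add: emeasure_lborel_Ioo)
qed

text \<open>The turning point sits at \<open>0\<close> and its image at \<open>1\<close>, so
  \<open>x\<close> is the critical orbit starting from the first image. Setting
  \<open>a (Suc n) = 0\<close> after a visit to \<open>0\<close> truncates the series there, which
  treats finite and infinite kneading sequences uniformly.\<close>

locale tent_orbit =
  fixes u v B :: real and x a :: "nat \<Rightarrow> real"
  assumes u: "0 < u" "u < 1" and v: "0 < v" "v < 1"
    and x_0 [simp]: "x 0 = 1" and a_0 [simp]: "a 0 = 1"
    and left: "\<And>n. x n < 0 \<Longrightarrow> a (Suc n) = u * a n \<and> x (Suc n) = 1 + x n / u"
    and right: "\<And>n. 0 < x n \<Longrightarrow> a (Suc n) = - v * a n \<and> x (Suc n) = 1 - x n / v"
    and turn: "\<And>n. x n = 0 \<Longrightarrow> a (Suc n) = 0 \<and> x (Suc n) = 1"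
    and x_bound: "\<And>n. \<bar>x n\<bar> \<le> B"
begin

definition q :: real where "q = max u v"

lemma q: "0 < q" "q < 1" "u \<le> q" "v \<le> q"
  using u v by (auto simp: q_def)

lemma abs_a_le: "\<bar>a n\<bar> \<le> q ^ n"
proof (induction n)
  case (Suc n)
  have "\<bar>a (Suc n)\<bar> \<le> q * \<bar>a n\<bar>"
    using left[of n] right[of n] turn[of n] q u v
    by (cases "x n" "0 :: real" rule: linorder_cases) (auto simp: abs_mult intro: mult_right_mono)
  also have "\<dots> \<le> q * q ^ n" using Suc q by (intro mult_left_mono) auto
  finally show ?case by simp
qed simp

lemma summable_abs_a: "summable (\<lambda>n. \<bar>a n\<bar>)"
  by (rule summable_comparison_test'[of "\<lambda>n. q ^ n" 0]) (use abs_a_le q in \<open>auto simp: summable_geometric\<close>)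

lemma summable_a_times:
  assumes "\<And>n. \<bar>c n\<bar> \<le> K" shows "summable (\<lambda>n. a n * c n)"
proof (rule summable_comparison_test'[of "\<lambda>n. \<bar>a n\<bar> * K" 0])
  show "summable (\<lambda>n. \<bar>a n\<bar> * K)" using summable_abs_a by (rule summable_mult2)
  show "norm (a n * c n) \<le> \<bar>a n\<bar> * K" for n
    using assms[of n] by (simp add: abs_mult mult_left_mono)
qed

text \<open>Both branches have the form \<open>1 + x n / s\<close> with
  \<open>a (Suc n) = s * a n\<close>, and at the turning point both sides vanish. Hence the partial
  sums of \<open>a\<close> telescope.\<close>

lemma a_Suc_mult_x_Suc: "a (Suc n) * x (Suc n) = a (Suc n) + a n * x n"
proof (cases "x n" "0 :: real" rule: linorder_cases)
  case less
  then show ?thesis using left[of n] u by (simp add: distrib_left)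
next
  case equal
  then show ?thesis using turn[of n] by simp
next
  case greater
  then show ?thesis using right[of n] v by (simp add: right_diff_distrib)
qed

lemma x_le_1: "x n \<le> 1"
proof (cases n)
  case (Suc m)
  then show ?thesis
    using left[of m] right[of m] turn[of m] u v
    by (cases "x m" "0 :: real" rule: linorder_cases) (auto simp: divide_le_0_iff)
qed simp

text \<open>Only the turning point is mapped to \<open>1\<close>, and its visit has already
  truncated \<open>a\<close>. So near \<open>1\<close> no later term competes with
  \<open>n = 0\<close> in \<open>rho\<close>.\<close>

lemma a_eq_0_if_x_eq_1:
  assumes "x (Suc n) = 1" shows "a (Suc n) = 0"
proof -
  have "x n = 0"
  proof (cases "x n" "0 :: real" rule: linorder_cases)
    case less
    then show ?thesis using left[of n] u assms by (simp add: divide_eq_0_iff)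
  next
    case greater
    then show ?thesis using right[of n] v assms by (simp add: divide_eq_0_iff)
  qed
  then show ?thesis using turn by blast
qed

lemma sum_a_atMost: "(\<Sum>k\<le>n. a k) = a n * x n"
  by (induction n) (auto simp: a_Suc_mult_x_Suc)

text \<open>The kneading equation: the partial sums are \<open>a n * x n\<close>, a decaying weight
  times a bounded orbit.\<close>

lemma a_sums_0: "a sums 0"
proof -
  have "(\<lambda>n. a n * x n) \<longlonglongrightarrow> 0"
    using summable_a_times[of x B] x_bound by (intro summable_LIMSEQ_zero) auto
  then have "(\<lambda>n. \<Sum>k\<le>n. a k) \<longlonglongrightarrow> 0" by (simp add: sum_a_atMost)
  then show ?thesis by (simp add: sums_def_le)
qed

section \<open>The invariant density and its transfer equation\<close>

text \<open>The density of the (a priori signed) absolutely continuous invariant measure, in the form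
  found by Parry. Its total mass is \<open>\<Sum>n. a n * x n\<close>, which equals \<open>- (\<Sum>n. n * a n)\<close> by partial
  summation.\<close>
definition rho :: "real \<Rightarrow> real" where
  "rho y = (\<Sum>n. a n * of_bool (y < x n))"

lemma summable_rho: "summable (\<lambda>n. a n * of_bool (P n))"
  by (rule summable_a_times[where K = 1]) auto

text \<open>The fixed point equation of the transfer operator, with inverse branches
  \<open>- u + u * y\<close> and \<open>v - v * y\<close>. Orbit points are excluded because the
  decreasing branch reverses the strict inequality in \<open>rho\<close>.\<close>

lemma rho_functional_equation:
  assumes "y < 1" "y \<notin> range x"
  shows "rho y = u * rho (- u + u * y) + v * rho (v + - v * y)"
proof -
  have ne: "y \<noteq> x n" for n using assms(2) by auto
  have gl: "- u + u * y < 0" and gr: "0 < v + - v * y" using u v assms(1) by (auto simp: algebra_simps)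
  \<comment> \<open>Only the branch on the side of \<open>x n\<close> sees the position of
    \<open>y\<close>. The other inverse branch contributes \<open>u * a n\<close> if
    \<open>x n\<close> is positive and nothing if \<open>x n\<close> is negative.\<close>
  have termwise: "u * (a n * of_bool (- u + u * y < x n)) + v * (a n * of_bool (v + - v * y < x n))
      = u * a n - a (Suc n) + a (Suc n) * of_bool (y < x (Suc n))" (is "?l n = ?r n") for n
  proof (cases "x n" "0 :: real" rule: linorder_cases)
    case less
    have "(y < 1 + x n / u) = (- u + u * y < x n)"
      using u by (simp add: field_simps)
    then have "(y < x (Suc n)) = (- u + u * y < x n)" using left[OF less] by simp
    moreover have "\<not> v + - v * y < x n" using less gr by linarith
    ultimately show ?thesis using left[OF less] by simp
  next
    case equal
    with turn[OF equal] gl gr show ?thesis by simp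
  next
    case greater
    have "(1 - x n / v < y) = (v + - v * y < x n)"
      using v by (simp add: field_simps)
    then have "(x (Suc n) < y) = (v + - v * y < x n)" using right[OF greater] by simp
    moreover have "(x (Suc n) < y) = (\<not> y < x (Suc n))" using ne[of "Suc n"] by auto
    ultimately have "of_bool (v + - v * y < x n) = (1 - of_bool (y < x (Suc n)) :: real)" by auto
    moreover have "- u + u * y < x n" using greater gl by linarith
    moreover have "a (Suc n) = - v * a n" using right[OF greater] by simp
    ultimately show ?thesis by (simp only: of_bool_eq_1_iff) (simp add: algebra_simps)
  qed
  have "(\<lambda>n. ?l n) sums (u * rho (- u + u * y) + v * rho (v + - v * y))"
    unfolding rho_def by (intro sums_add sums_mult summable_sums summable_rho)
  \<comment> \<open>Both shifted series lose their term at \<open>n = 0\<close>. The two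
    corrections, each equal to \<open>1\<close> as \<open>y < 1\<close>, cancel.\<close>
  moreover have "(\<lambda>n. ?r n) sums (u * 0 - (0 - a 0) + (rho y - a 0 * of_bool (y < x 0)))"
  proof (intro sums_add sums_diff sums_mult a_sums_0)
    show "(\<lambda>n. a (Suc n)) sums (0 - a 0)"
      using a_sums_0 by (subst sums_Suc_iff) simp
    show "(\<lambda>n. a (Suc n) * of_bool (y < x (Suc n))) sums (rho y - a 0 * of_bool (y < x 0))"
      unfolding rho_def using summable_sums[OF summable_rho] by (subst sums_Suc_iff) simp
  qed
  ultimately have "u * rho (- u + u * y) + v * rho (v + - v * y) = u * 0 - (0 - a 0) + (rho y - a 0 * of_bool (y < x 0))"
    unfolding termwise by (rule sums_unique2)
  with assms show ?thesis by simp
qed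

text \<open>Dominated convergence with majorant \<open>\<bar>a n\<bar>\<close>: one-sided limits of
  \<open>rho\<close> may be taken term by term.\<close>

lemma rho_tendsto:
  assumes "\<And>n. ((\<lambda>y. a n * of_bool (y < x n)) \<longlongrightarrow> b n) F" "F \<noteq> bot"
  shows "(rho \<longlongrightarrow> (\<Sum>n. b n)) F"
  unfolding rho_def
proof (rule tannerys_theorem[THEN conjunct2, THEN conjunct2])
  show "((\<lambda>y. a n * of_bool (y < x n)) \<longlongrightarrow> b n) F" for n by (rule assms)
  show "summable (\<lambda>n. \<bar>a n\<bar>)" by (rule summable_abs_a)
  have "(\<lambda>(n, y). norm (a n * of_bool (y < x n)) \<le> \<bar>a n\<bar>) = (\<lambda>_. True)"
    by (auto simp: abs_mult)
  then show "eventually (\<lambda>(n, y). norm (a n * of_bool (y < x n)) \<le> \<bar>a n\<bar>) (sequentially \<times>\<^sub>F F)"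
    by simp
qed (rule assms)

lemma rho_tendsto_at_right: "(rho \<longlongrightarrow> rho y) (at_right y)"
  unfolding rho_def[of y]
proof (rule rho_tendsto)
  fix n
  have "eventually (\<lambda>z. of_bool (z < x n) = (of_bool (y < x n) :: real)) (at_right y)"
  proof (cases "y < x n")
    case True
    then have "eventually (\<lambda>z. z \<in> {y<..<x n}) (at_right y)" by (rule eventually_at_right_real)
    then show ?thesis by eventually_elim (use True in auto)
  next
    case False
    then show ?thesis by (auto simp: eventually_at_right_field intro!: exI[of _ "y + 1"])
  qed
  then have "eventually (\<lambda>z. a n * of_bool (z < x n) = a n * (of_bool (y < x n) :: real)) (at_right y)"
    by eventually_elim simp
  then show "((\<lambda>z. a n * of_bool (z < x n)) \<longlongrightarrow> a n * of_bool (y < x n)) (at_right y)"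
    by (rule tendsto_eventually)
qed simp

lemma rho_tendsto_at_left_1: "(rho \<longlongrightarrow> 1) (at_left 1)"
proof -
  have "(rho \<longlongrightarrow> (\<Sum>n. of_bool (n = 0))) (at_left 1)"
  proof (rule rho_tendsto)
    fix n
    have "eventually (\<lambda>z. a n * of_bool (z < x n) = (of_bool (n = 0) :: real)) (at_left 1)"
    proof (cases n)
      case 0
      then show ?thesis by (auto simp: eventually_at_left_field intro!: exI[of _ 0])
    next
      case (Suc m)
      show ?thesis
      proof (cases "x n = 1")
        case True
        then show ?thesis using a_eq_0_if_x_eq_1[of m] Suc by simp
      next
        case False
        then have "x n < 1" using x_le_1[of n] by simp
        then have "eventually (\<lambda>z. z \<in> {x n<..<1}) (at_left 1)" by (rule eventually_at_left_real)
        then show ?thesis by eventually_elim (use Suc in auto)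
      qed
    qed
    then show "((\<lambda>z. a n * of_bool (z < x n)) \<longlongrightarrow> of_bool (n = 0)) (at_left 1)"
      by (rule tendsto_eventually)
  qed simp
  moreover have "(\<Sum>n. of_bool (n = 0) :: real) = 1"
    using sums_single[of 0 "\<lambda>_. 1 :: real"] by (simp add: sums_iff of_bool_def)
  ultimately show ?thesis by simp
qed

text \<open>To the left of all orbit points every term counts and the kneading equation applies; to
  the right no term counts.\<close>

lemma rho_eq_0: "y < - B \<or> B \<le> y \<Longrightarrow> rho y = 0"
proof (elim disjE)
  assume "y < - B"
  then have "y < x n" for n using x_bound[of n] by auto
  then show ?thesis unfolding rho_def using a_sums_0 by (simp add: sums_unique[symmetric])
next
  assume "B \<le> y"
  then have "\<not> y < x n" for n using x_bound[of n] by auto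
  then show ?thesis unfolding rho_def by simp
qed

lemma
  shows integrable_rho: "integrable lborel rho"
    and rho_mass: "(\<lambda>n. a n * x n) sums (\<integral>y. rho y \<partial>lborel)"
proof -
  \<comment> \<open>A single step function in \<open>rho\<close> is not integrable at minus infinity
    unless its coefficient is zero. Subtracting \<open>a n * of_bool (y < 0)\<close> gives bounded
    support and leaves the total unchanged, since \<open>a\<close> sums to \<open>0\<close>.\<close>
  define f :: "nat \<Rightarrow> real \<Rightarrow> real"
    where "f n y = a n * (indicator {0..<x n} y - indicator {x n..<0} y)" for n y
  have rho: "rho = (\<lambda>y. \<Sum>n. f n y)"
  proof
    fix y
    have "f n y = a n * of_bool (y < x n) - a n * of_bool (y < 0)" for n
      by (auto simp: f_def indicator_def)
    moreover have "(\<lambda>n. a n * of_bool (y < x n) - a n * of_bool (y < 0)) sums (rho y - 0 * of_bool (y < 0))"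
      unfolding rho_def by (intro sums_diff summable_sums summable_rho sums_mult2 a_sums_0)
    ultimately show "rho y = (\<Sum>n. f n y)" by (simp add: sums_unique)
  qed
  have int1: "integrable lborel (\<lambda>y. indicator {c..<d} y :: real)" for c d :: real
    by (cases "c \<le> d") (auto intro: integrable_real_indicator)
  have int: "integrable lborel (f n)" for n
    unfolding f_def by (intro integrable_mult_right Bochner_Integration.integrable_diff int1)
  have integral1: "(\<integral>y. indicator {c..<d} y \<partial>lborel) = max 0 (d - c)" for c d :: real
    by (cases "c \<le> d") (simp_all add: measure_def)
  have integral: "(\<integral>y. f n y \<partial>lborel) = a n * x n" for n
    unfolding f_def by (subst integral_mult_right_zero, subst Bochner_Integration.integral_diff)
      (simp_all only: int1 integral1, auto simp: max_def)
  have norm: "norm (f n y) = \<bar>a n\<bar> * (indicator {0..<x n} y + indicator {x n..<0} y)" for n y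
    unfolding f_def real_norm_def abs_mult by (auto simp: indicator_def)
  have integral_norm: "(\<integral>y. norm (f n y) \<partial>lborel) = \<bar>a n\<bar> * \<bar>x n\<bar>" for n
    unfolding norm by (subst integral_mult_right_zero, subst Bochner_Integration.integral_add)
      (simp_all only: int1 integral1, auto simp: max_def)
  have "summable (\<lambda>n. norm (f n y))" for y
    unfolding norm
    by (rule summable_comparison_test'[OF summable_abs_a, of 0]) (auto simp: indicator_def abs_mult)
  moreover have "summable (\<lambda>n. \<integral>y. norm (f n y) \<partial>lborel)"
    unfolding integral_norm
    by (rule summable_comparison_test'[OF summable_mult2[OF summable_abs_a, of B], of 0])
       (use x_bound in \<open>simp add: abs_mult mult_left_mono\<close>)
  ultimately show "integrable lborel rho" "(\<lambda>n. a n * x n) sums (\<integral>y. rho y \<partial>lborel)"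
    using integrable_suminf[of lborel f] sums_integral[of lborel f] int by (simp_all add: rho integral)
qed

lemma rho_measurable [measurable]: "rho \<in> borel_measurable borel"
  using borel_measurable_integrable[OF integrable_rho] by simp

text \<open>The transfer operator preserves the \<open>L\<^sup>1\<close> norm of \<open>rho\<close>, so no cancellation can take place
  between the contributions of the two preimages.\<close>
lemma AE_rho_neg:
  "AE y in lborel. y < 1 \<and> (rho (- u + u * y) < 0 \<or> rho (v + - v * y) < 0) \<longrightarrow> rho y < 0"
proof -
  \<comment> \<open>Here \<open>h\<close> is the transfer operator applied to
    \<open>\<bar>rho z\<bar>\<close>. Affine substitution on each side of \<open>0\<close> shows
    that it has the same integral, while the triangle inequality gives
    \<open>h y \<ge> \<bar>rho y\<bar>\<close>; so the two agree almost everywhere.\<close>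
  define fl fr h where "fl z = \<bar>rho z\<bar> * indicator {..<0} z" and "fr z = \<bar>rho z\<bar> * indicator {0<..} z"
    and "h y = u * fl (- u + u * y) + v * fr (v + - v * y)" for z y
  have gl: "- u + u * y < 0 \<longleftrightarrow> y < 1" and gr: "0 < v + - v * y \<longleftrightarrow> y < 1" for y
    using u v by (auto simp: algebra_simps)
  have h: "h y = (if y < 1 then u * \<bar>rho (- u + u * y)\<bar> + v * \<bar>rho (v + - v * y)\<bar> else 0)" for y
    using gl[of y] gr[of y] by (auto simp: h_def fl_def fr_def indicator_def)
  have int_rho: "integrable lborel (\<lambda>z. \<bar>rho z\<bar>)" using integrable_rho by (rule integrable_abs)
  have int_fl: "integrable lborel fl" and int_fr: "integrable lborel fr"
    unfolding fl_def fr_def by (rule integrable_real_mult_indicator; use int_rho in simp)+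
  have int_hl: "integrable lborel (\<lambda>y. u * fl (- u + u * y))"
    using u by (intro integrable_mult_right lborel_integrable_real_affine int_fl) auto
  have int_hr: "integrable lborel (\<lambda>y. v * fr (v + - v * y))"
    using v by (intro integrable_mult_right lborel_integrable_real_affine int_fr) auto
  have int_h: "integrable lborel h"
    unfolding h_def by (intro Bochner_Integration.integrable_add int_hl int_hr)
  have "(\<integral>y. h y \<partial>lborel) = (\<integral>y. fl y \<partial>lborel) + (\<integral>y. fr y \<partial>lborel)"
    unfolding h_def
    using lborel_integral_real_affine[of u fl "- u"] lborel_integral_real_affine[of "- v" fr v] u v int_hl int_hr
    by (simp add: Bochner_Integration.integral_add)
  also have "\<dots> = (\<integral>y. fl y + fr y \<partial>lborel)"
    using int_fl int_fr by (simp add: Bochner_Integration.integral_add)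
  also have "\<dots> = (\<integral>y. \<bar>rho y\<bar> \<partial>lborel)"
  proof (rule integral_cong_AE)
    have "AE y in lborel. y \<noteq> (0 :: real)" by (rule AE_lborel_singleton)
    then show "AE y in lborel. fl y + fr y = \<bar>rho y\<bar>"
      by eventually_elim (auto simp: fl_def fr_def indicator_def)
  qed (use int_fl int_fr int_rho in auto)
  finally have eq: "(\<integral>y. h y - \<bar>rho y\<bar> \<partial>lborel) = 0"
    using int_h int_rho by (simp add: Bochner_Integration.integral_diff)
  have "AE y in lborel. y \<notin> range x"
    by (rule AE_not_in) (auto intro: countable_imp_null_set_lborel)
  moreover have "AE y in lborel. y \<noteq> (1 :: real)" by (rule AE_lborel_singleton)
  ultimately have *: "AE y in lborel. 0 \<le> h y - \<bar>rho y\<bar> \<and> (y < 1 \<longrightarrow> rho y = u * rho (- u + u * y) + v * rho (v + - v * y))"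
  proof eventually_elim
    case (elim y)
    show ?case
    proof (cases "y < 1")
      case True
      with elim have "rho y = u * rho (- u + u * y) + v * rho (v + - v * y)" by (intro rho_functional_equation) auto
      moreover have "\<bar>u * rho (- u + u * y) + v * rho (v + - v * y)\<bar> \<le> u * \<bar>rho (- u + u * y)\<bar> + v * \<bar>rho (v + - v * y)\<bar>"
        using u v by (metis abs_mult abs_of_pos abs_triangle_ineq)
      ultimately show ?thesis using True by (simp add: h)
    next
      case False
      then have "\<not> y < x n" for n using x_le_1[of n] by auto
      then have "rho y = 0" by (simp add: rho_def)
      with False show ?thesis by (simp add: h)
    qed
  qed
  then have "AE y in lborel. 0 \<le> h y - \<bar>rho y\<bar>" by eventually_elim simp
  then have "AE y in lborel. h y - \<bar>rho y\<bar> = 0"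
    using eq int_h int_rho by (subst (asm) integral_nonneg_eq_0_iff_AE) auto
  with * show ?thesis
  proof eventually_elim
    case (elim y)
    show ?case
    proof (intro impI, elim conjE)
      assume y: "y < 1" and neg: "rho (- u + u * y) < 0 \<or> rho (v + - v * y) < 0"
      define p r where "p = u * rho (- u + u * y)" and "r = v * rho (v + - v * y)"
      \<comment> \<open>Equality in the triangle inequality excludes opposite signs, so one negative
        term makes the sum negative.\<close>
      have "\<bar>p + r\<bar> = \<bar>p\<bar> + \<bar>r\<bar>"
        using elim y u v by (auto simp: h p_def r_def abs_mult)
      moreover have "p < 0 \<or> r < 0" using neg u v by (auto simp: p_def r_def mult_pos_neg)
      ultimately have "p + r < 0" by linarith
      then show "rho y < 0" using elim y by (auto simp: p_def r_def)
    qed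
  qed
qed

section \<open>Intervals of negativity and their expansion\<close>

definition neg_on :: "real \<Rightarrow> real \<Rightarrow> bool" where
  "neg_on c d \<longleftrightarrow> (AE y in lborel. c < y \<and> y < d \<longrightarrow> rho y < 0)"

lemma neg_on_subset: "neg_on c d \<Longrightarrow> c \<le> c' \<Longrightarrow> d' \<le> d \<Longrightarrow> neg_on c' d'"
  unfolding neg_on_def by (erule eventually_mono) auto

text \<open>Each point of the image interval has its left preimage in \<open>(c, d)\<close>, so one
  of its two contributions is negative. Pulling back along an affine map keeps the exceptional set
  null.\<close>

lemma neg_on_left:
  assumes "neg_on c d" "d \<le> 0" shows "neg_on (1 + c / u) (1 + d / u)"
proof -
  have "AE y in lborel. c < - u + u * y \<and> - u + u * y < d \<longrightarrow> rho (- u + u * y) < 0"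
    by (rule AE_borel_affine) (use u assms(1) in \<open>auto simp: neg_on_def\<close>)
  with AE_rho_neg show ?thesis unfolding neg_on_def
  proof eventually_elim
    case (elim y)
    show ?case
    proof (intro impI, elim conjE)
      assume y: "1 + c / u < y" "y < 1 + d / u"
      have "c < - u + u * y" "- u + u * y < d" using y u by (auto simp: field_simps)
      moreover from this(2) have "y < 1" using assms(2) u by (auto simp: algebra_simps dest: mult_less_cancel_left_pos[THEN iffD1, of u y 1])
      ultimately show "rho y < 0" using elim by auto
    qed
  qed
qed

lemma neg_on_right:
  assumes "neg_on c d" "0 \<le> c" shows "neg_on (1 - d / v) (1 - c / v)"
proof -
  have "AE y in lborel. c < v + - v * y \<and> v + - v * y < d \<longrightarrow> rho (v + - v * y) < 0"
    by (rule AE_borel_affine) (use v assms(1) in \<open>auto simp: neg_on_def\<close>)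
  with AE_rho_neg show ?thesis unfolding neg_on_def
  proof eventually_elim
    case (elim y)
    show ?case
    proof (intro impI, elim conjE)
      assume y: "1 - d / v < y" "y < 1 - c / v"
      have "c < v + - v * y" "v + - v * y < d" using y v by (auto simp: field_simps)
      moreover have "y < 1" using assms(2) v y(2) divide_nonneg_pos[of c v] by linarith
      ultimately show "rho y < 0" using elim by auto
    qed
  qed
qed

text \<open>The left limit of \<open>rho\<close> at \<open>1\<close> is \<open>1\<close>, so
  \<open>rho\<close> is positive on a whole interval ending at \<open>1\<close>.\<close>

lemma not_neg_on_1:
  assumes "c < 1" shows "\<not> neg_on c 1"
proof
  assume neg: "neg_on c 1"
  have "eventually (\<lambda>y. rho y > 0) (at_left 1)"
    using order_tendstoD(1)[OF rho_tendsto_at_left_1, of 0] by simp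
  then obtain b where b: "b < 1" "\<And>y. b < y \<Longrightarrow> y < 1 \<Longrightarrow> 0 < rho y"
    unfolding eventually_at_left_field by auto
  have "AE y in lborel. \<not> (max b c < y \<and> y < 1)"
    using neg unfolding neg_on_def
  proof eventually_elim
    case (elim y)
    then show ?case using b(2)[of y] by auto
  qed
  then have "1 \<le> max b c" by (rule AE_lborel_interval_empty)
  with b(1) assms show False by simp
qed

lemma neg_on_bounded:
  assumes "neg_on c d" "c < d" shows "d - c \<le> 2 * B"
proof -
  have "AE y in lborel. \<not> (c < y \<and> y < min d (- B))"
    using assms(1) unfolding neg_on_def by (rule eventually_mono) (auto simp: rho_eq_0)
  then have "min d (- B) \<le> c" by (rule AE_lborel_interval_empty)
  moreover have "AE y in lborel. \<not> (max c B < y \<and> y < d)"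
    using assms(1) unfolding neg_on_def by (rule eventually_mono) (auto simp: rho_eq_0)
  then have "d \<le> max c B" by (rule AE_lborel_interval_empty)
  ultimately show ?thesis using assms(2) by linarith
qed

text \<open>Intervals on which \<open>rho\<close> is negative are expanded by the map, and never reach the turning
  point because \<open>rho\<close> is positive just below its image.\<close>
lemma not_neg_on:
  assumes "c < d" shows "\<not> neg_on c d"
proof
  assume neg: "neg_on c d"
  \<comment> \<open>Both slopes have modulus at least \<open>1 / q\<close>, so the lengths grow
    geometrically and finally exceed \<open>2 * B\<close>, the length bound of
    \<open>neg_on_bounded\<close>.\<close>
  have "\<exists>c' d'. neg_on c' d' \<and> (d - c) * (1 / q) ^ n \<le> d' - c'" for n
  proof (induction n)
    case 0
    then show ?case using neg by auto
  next
    case (Suc n)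
    then obtain c' d' where IH: "neg_on c' d'" "(d - c) * (1 / q) ^ n \<le> d' - c'" by blast
    have "0 < (d - c) * (1 / q) ^ n" using assms q by simp
    then have pos: "0 < d' - c'" using IH(2) by linarith
    have "(d - c) * (1 / q) ^ Suc n = ((d - c) * (1 / q) ^ n) / q" by simp
    also have "\<dots> \<le> (d' - c') / q" using IH(2) q by (intro divide_right_mono) auto
    finally have le: "(d - c) * (1 / q) ^ Suc n \<le> (d' - c') / q" .
    consider "d' \<le> 0" | "0 \<le> c'" | "c' < 0" "0 < d'" by linarith
    then show ?case
    proof cases
      case 1
      have "(d' - c') / q \<le> (d' - c') / u" using pos q u by (intro divide_left_mono) auto
      with le have "(d - c) * (1 / q) ^ Suc n \<le> (1 + d' / u) - (1 + c' / u)" by (simp add: diff_divide_distrib)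
      with neg_on_left[OF IH(1) 1] show ?thesis by blast
    next
      case 2
      have "(d' - c') / q \<le> (d' - c') / v" using pos q v by (intro divide_left_mono) auto
      with le have "(d - c) * (1 / q) ^ Suc n \<le> (1 - c' / v) - (1 - d' / v)" by (simp add: diff_divide_distrib)
      with neg_on_right[OF IH(1) 2] show ?thesis by blast
    next
      case 3
      \<comment> \<open>If the turning point is interior, the part to its right is mapped onto an
        interval ending at \<open>1\<close>, which is impossible.\<close>
      then have "neg_on 0 d'" using neg_on_subset[OF IH(1)] by simp
      from neg_on_right[OF this] have "neg_on (1 - d' / v) 1" by simp
      moreover have "1 - d' / v < 1" using 3 v by simp
      ultimately show ?thesis using not_neg_on_1 by blast
    qed
  qed
  moreover obtain n where "2 * B / (d - c) < (1 / q) ^ n"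
    using real_arch_pow[of "1 / q"] q by auto
  then have n: "2 * B < (d - c) * (1 / q) ^ n" using assms by (simp add: field_simps)
  ultimately obtain c' d' where *: "neg_on c' d'" "2 * B < d' - c'" by (meson less_le_trans)
  moreover have "0 \<le> B" using x_bound[of 0] by simp
  ultimately show False using neg_on_bounded[of c' d'] by linarith
qed

text \<open>By right continuity a single negative value would spread to an interval.\<close>

lemma rho_nonneg: "0 \<le> rho y"
proof (rule ccontr)
  assume "\<not> 0 \<le> rho y"
  then have "eventually (\<lambda>z. rho z < 0) (at_right y)"
    using order_tendstoD(2)[OF rho_tendsto_at_right, of y 0] by simp
  then obtain d where "y < d" "\<And>z. y < z \<Longrightarrow> z < d \<Longrightarrow> rho z < 0"
    unfolding eventually_at_right_field by auto
  then show False using not_neg_on[of y d] by (auto simp: neg_on_def)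
qed

lemma integral_rho_pos: "0 < (\<integral>y. rho y \<partial>lborel)"
proof (rule ccontr)
  assume "\<not> 0 < (\<integral>y. rho y \<partial>lborel)"
  moreover have "0 \<le> (\<integral>y. rho y \<partial>lborel)" by (simp add: rho_nonneg)
  ultimately have "(\<integral>y. rho y \<partial>lborel) = 0" by simp
  then have ae: "AE y in lborel. rho y = 0"
    using integral_nonneg_eq_0_iff_AE[OF integrable_rho] rho_nonneg by simp
  have "eventually (\<lambda>y. rho y > 0) (at_left 1)"
    using order_tendstoD(1)[OF rho_tendsto_at_left_1, of 0] by simp
  then obtain b where b: "b < 1" "\<And>y. b < y \<Longrightarrow> y < 1 \<Longrightarrow> 0 < rho y"
    unfolding eventually_at_left_field by auto
  from ae have "AE y in lborel. \<not> (b < y \<and> y < 1)"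
    by eventually_elim (use b(2) in force)
  then have "1 \<le> b" by (rule AE_lborel_interval_empty)
  with b(1) show False by simp
qed

section \<open>The first moment of the coefficients\<close>

lemma summable_index_a: "summable (\<lambda>n. \<bar>real n * a n\<bar>)"
proof (rule summable_comparison_test')
  show "summable (\<lambda>n. of_nat (Suc n) * q ^ n)"
    using geometric_deriv_sums[of q] q by (auto intro: sums_summable)
  show "norm \<bar>real n * a n\<bar> \<le> of_nat (Suc n) * q ^ n" for n
    using abs_a_le[of n] q by (auto simp: abs_mult intro!: mult_mono)
qed

lemma suminf_index_a_neg: "(\<Sum>n. real n * a n) < 0"
proof -
  \<comment> \<open>Abel summation, using that \<open>a k * x k\<close> is the partial sum of
    \<open>a\<close> up to \<open>k\<close>; the boundary term tends to \<open>0\<close>.\<close>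
  have eq: "(\<Sum>k<n. a k * x k) = real n * (a n * x n) - (\<Sum>k\<le>n. real k * a k)" for n
    by (induction n) (auto simp: a_Suc_mult_x_Suc algebra_simps)
  have "summable (\<lambda>n. real n * (a n * x n))"
  proof (rule summable_comparison_test'[OF summable_mult2[OF summable_index_a, of B], of 0])
    show "norm (real n * (a n * x n)) \<le> \<bar>real n * a n\<bar> * B" for n
      using x_bound[of n] by (simp add: abs_mult mult.assoc mult_left_mono)
  qed
  then have "(\<lambda>n. real n * (a n * x n)) \<longlonglongrightarrow> 0" by (rule summable_LIMSEQ_zero)
  moreover have "(\<lambda>n. \<Sum>k\<le>n. real k * a k) \<longlonglongrightarrow> (\<Sum>n. real n * a n)"
    using summable_rabs_cancel[OF summable_index_a] by (rule summable_LIMSEQ')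
  ultimately have "(\<lambda>n. \<Sum>k<n. a k * x k) \<longlonglongrightarrow> 0 - (\<Sum>n. real n * a n)"
    unfolding eq by (rule tendsto_diff)
  then have "(\<integral>y. rho y \<partial>lborel) = - (\<Sum>n. real n * a n)"
    using rho_mass unfolding sums_def by (simp add: LIMSEQ_unique)
  with integral_rho_pos show ?thesis by simp
qed

end


section \<open>The kneading sequence as a power series\<close>

primrec weight :: "real \<Rightarrow> real \<Rightarrow> sym \<Rightarrow> real" where
  "weight u v L = u"
| "weight u v C = 0"
| "weight u v R = - v"

text \<open>The shift \<open>Suc i\<close> skips index \<open>0\<close>, where
  \<open>ext_kneading\<close> always has the symbol \<open>C\<close>, whose weight \<open>0\<close>
  would annihilate every product.\<close>

definition kneading_coeff :: "(nat \<Rightarrow> sym) \<Rightarrow> real \<Rightarrow> real \<Rightarrow> nat \<Rightarrow> real" where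
  "kneading_coeff e u v n = (\<Prod>i<n. weight u v (e (Suc i)))"

lemma kneading_coeff_simps [simp]:
  "kneading_coeff e u v 0 = 1"
  "kneading_coeff e u v (Suc n) = kneading_coeff e u v n * weight u v (e (Suc n))"
  by (simp_all add: kneading_coeff_def)

text \<open>Equal finite kneading sequences agree up to the first \<open>C\<close>, and its weight
  \<open>0\<close> makes all later coefficients vanish on both sides.\<close>

lemma kneading_eq_imp_kneading_coeff_eq:
  assumes "kneading \<alpha> \<beta> = kneading \<alpha>' \<beta>'"
  shows "kneading_coeff (ext_kneading \<alpha> \<beta>) u v n = kneading_coeff (ext_kneading \<alpha>' \<beta>') u v n"
proof -
  define e e' where "e = ext_kneading \<alpha> \<beta>" and "e' = ext_kneading \<alpha>' \<beta>'"
  show ?thesis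
  proof (cases "\<forall>n\<ge>1. e n \<noteq> C")
    case True
    then have "\<forall>n\<ge>1. e' n \<noteq> C" "(\<lambda>i. e (Suc i)) = (\<lambda>i. e' (Suc i))"
      using assms by (auto simp: kneading_def e_def e'_def split: if_splits)
    then show ?thesis by (simp add: kneading_coeff_def e_def e'_def fun_eq_iff)
  next
    case False
    define N N' where "N = (LEAST n. n \<ge> 1 \<and> e n = C)" and "N' = (LEAST n. n \<ge> 1 \<and> e' n = C)"
    have False': "\<not> (\<forall>n\<ge>1. e' n \<noteq> C)"
      using assms False by (auto simp: kneading_def e_def e'_def split: if_splits)
    have eq: "map e [1..<Suc N] = map e' [1..<Suc N']"
      using assms False False' unfolding kneading_def e_def e'_def N_def N'_def by (simp only: if_False kseq.inject)
    then have "length (map e [1..<Suc N]) = length (map e' [1..<Suc N'])" by (rule arg_cong)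
    then have N: "N' = N" by (simp del: upt_Suc)
    have "N \<ge> 1 \<and> e N = C" unfolding N_def by (rule LeastI_ex) (use False in auto)
    then have "N \<ge> 1" "e N = C" by auto
    have e: "e i = e' i" if "1 \<le> i" "i \<le> N" for i
      using eq that unfolding N by (simp add: map_eq_conv del: upt_Suc)
    show ?thesis
    proof (cases "n < N")
      case True
      then show ?thesis
        unfolding kneading_coeff_def e_def[symmetric] e'_def[symmetric] by (intro prod.cong refl) (simp add: e)
    next
      case False
      have "weight u v (e (Suc (N - 1))) = 0" "weight u v (e' (Suc (N - 1))) = 0"
        using \<open>N \<ge> 1\<close> \<open>e N = C\<close> e[of N] by auto
      moreover have "N - 1 \<in> {..<n}" using False \<open>N \<ge> 1\<close> by auto
      ultimately show ?thesis
        unfolding kneading_coeff_def e_def[symmetric] e'_def[symmetric]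
        by (metis (no_types, lifting) finite_lessThan prod_zero)
    qed
  qed
qed

text \<open>Supplies the orbit bound \<open>x_bound\<close> of the locale, with
  \<open>B = 1 / (\<beta> - \<alpha>)\<close>.\<close>

lemma skew_tent_funpow_in_unit:
  assumes "0 < \<alpha>" "\<alpha> < 1" "0 < \<beta>" "\<beta> \<le> 1"
  shows "(skew_tent \<alpha> \<beta> ^^ n) \<alpha> \<in> {0..1}"
proof (induction n)
  case (Suc n)
  define y where "y = (skew_tent \<alpha> \<beta> ^^ n) \<alpha>"
  have y: "0 \<le> y" "y \<le> 1" using Suc by (auto simp: y_def)
  have "skew_tent \<alpha> \<beta> y \<in> {0..1}"
  proof (cases "y \<le> \<alpha>")
    case True
    then have "\<beta> / \<alpha> * y \<le> \<beta> / \<alpha> * \<alpha>" using assms by (intro mult_left_mono) auto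
    also have "\<dots> = \<beta>" using assms by simp
    finally have "\<beta> / \<alpha> * y \<le> 1" using assms by linarith
    moreover have "0 \<le> \<beta> / \<alpha> * y" using y assms by (intro mult_nonneg_nonneg divide_nonneg_nonneg) auto
    ultimately show ?thesis using True by (simp only: skew_tent_def if_True atLeastAtMost_iff simp_thms)
  next
    case False
    then have "\<beta> / (1 - \<alpha>) * (1 - y) \<le> \<beta> / (1 - \<alpha>) * (1 - \<alpha>)" using assms by (intro mult_left_mono) auto
    also have "\<dots> = \<beta>" using assms by simp
    finally have "\<beta> / (1 - \<alpha>) * (1 - y) \<le> 1" using assms by linarith
    moreover have "0 \<le> \<beta> / (1 - \<alpha>) * (1 - y)"
      using y assms by (intro mult_nonneg_nonneg divide_nonneg_nonneg) auto
    ultimately show ?thesis using False by (simp only: skew_tent_def if_False atLeastAtMost_iff simp_thms)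
  qed
  then show ?case by (simp add: y_def)
qed (use assms in auto)

text \<open>The affine coordinate in which the turning point is \<open>0\<close> and its image is \<open>1\<close>; the slopes of
  the map become \<open>1 / u\<close> and \<open>- 1 / v\<close> with \<open>u = \<alpha> / \<beta>\<close> and \<open>v = (1 - \<alpha>) / \<beta>\<close>.\<close>
lemma tent_orbit_skew_tent:
  assumes "(\<alpha>, \<beta>) \<in> U_region"
  shows "tent_orbit (\<alpha> / \<beta>) ((1 - \<alpha>) / \<beta>) (1 / (\<beta> - \<alpha>))
    (\<lambda>n. ((skew_tent \<alpha> \<beta> ^^ Suc n) \<alpha> - \<alpha>) / (\<beta> - \<alpha>))
    (kneading_coeff (ext_kneading \<alpha> \<beta>) (\<alpha> / \<beta>) ((1 - \<alpha>) / \<beta>))"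
proof -
  have ab: "0 < \<alpha>" "\<alpha> < \<beta>" "\<beta> \<le> 1" "1 - \<beta> < \<alpha>" "0 < \<beta>" "\<alpha> < 1"
    using assms by (auto simp: U_region_def)
  define y where "y n = (skew_tent \<alpha> \<beta> ^^ Suc n) \<alpha>" for n
  have y_Suc: "y (Suc n) = skew_tent \<alpha> \<beta> (y n)" for n by (simp add: y_def)
  have e: "ext_kneading \<alpha> \<beta> (Suc n) = (if y n < \<alpha> then L else if y n = \<alpha> then C else R)" for n
    by (simp only: ext_kneading_def y_def Let_def)
  show ?thesis
    unfolding y_def[symmetric]
  proof
    show "(y 0 - \<alpha>) / (\<beta> - \<alpha>) = 1" using ab by (simp add: y_def skew_tent_def)
    fix n
    show "kneading_coeff (ext_kneading \<alpha> \<beta>) (\<alpha> / \<beta>) ((1 - \<alpha>) / \<beta>) (Suc n)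
        = \<alpha> / \<beta> * kneading_coeff (ext_kneading \<alpha> \<beta>) (\<alpha> / \<beta>) ((1 - \<alpha>) / \<beta>) n
      \<and> (y (Suc n) - \<alpha>) / (\<beta> - \<alpha>) = 1 + (y n - \<alpha>) / (\<beta> - \<alpha>) / (\<alpha> / \<beta>)"
      if "(y n - \<alpha>) / (\<beta> - \<alpha>) < 0"
    proof -
      have less: "y n < \<alpha>" using that ab by (simp add: divide_less_0_iff)
      have "y (Suc n) - \<alpha> = (\<beta> - \<alpha>) + (y n - \<alpha>) / (\<alpha> / \<beta>)"
        using less ab by (simp add: y_Suc skew_tent_def field_simps)
      then have "(y (Suc n) - \<alpha>) / (\<beta> - \<alpha>) = 1 + (y n - \<alpha>) / (\<alpha> / \<beta>) / (\<beta> - \<alpha>)"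
        using ab by (simp only: add_divide_distrib) simp
      then show ?thesis using less by (simp add: e ac_simps)
    qed
    show "kneading_coeff (ext_kneading \<alpha> \<beta>) (\<alpha> / \<beta>) ((1 - \<alpha>) / \<beta>) (Suc n)
        = - ((1 - \<alpha>) / \<beta>) * kneading_coeff (ext_kneading \<alpha> \<beta>) (\<alpha> / \<beta>) ((1 - \<alpha>) / \<beta>) n
      \<and> (y (Suc n) - \<alpha>) / (\<beta> - \<alpha>) = 1 - (y n - \<alpha>) / (\<beta> - \<alpha>) / ((1 - \<alpha>) / \<beta>)"
      if "0 < (y n - \<alpha>) / (\<beta> - \<alpha>)"
    proof -
      have less: "\<alpha> < y n" using that ab by (simp add: zero_less_divide_iff)
      have "y (Suc n) - \<alpha> = (\<beta> - \<alpha>) - (y n - \<alpha>) / ((1 - \<alpha>) / \<beta>)"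
        using less ab by (simp add: y_Suc skew_tent_def field_simps)
      then have "(y (Suc n) - \<alpha>) / (\<beta> - \<alpha>) = 1 - (y n - \<alpha>) / ((1 - \<alpha>) / \<beta>) / (\<beta> - \<alpha>)"
        using ab by (simp only: diff_divide_distrib[of "\<beta> - \<alpha>"]) simp
      then show ?thesis using less by (simp add: e ac_simps)
    qed
    show "kneading_coeff (ext_kneading \<alpha> \<beta>) (\<alpha> / \<beta>) ((1 - \<alpha>) / \<beta>) (Suc n) = 0
      \<and> (y (Suc n) - \<alpha>) / (\<beta> - \<alpha>) = 1"
      if "(y n - \<alpha>) / (\<beta> - \<alpha>) = 0"
      using that ab by (simp add: e y_Suc skew_tent_def)
    have "y n \<in> {0..1}"
      unfolding y_def using ab by (intro skew_tent_funpow_in_unit) auto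
    then have "\<bar>y n - \<alpha>\<bar> \<le> 1" using ab by auto
    then show "\<bar>(y n - \<alpha>) / (\<beta> - \<alpha>)\<bar> \<le> 1 / (\<beta> - \<alpha>)"
      using ab by (simp add: divide_right_mono)
  qed (use ab in auto)
qed

section \<open>Divided differences of the coefficients\<close>

text \<open>A discrete product rule: one factor is replaced by its derivative in direction
  \<open>(du, dv)\<close>, earlier factors are taken at \<open>(u, v)\<close> and later ones at
  \<open>(u0, v0)\<close>. On the diagonal this is the directional derivative of
  \<open>kneading_coeff\<close>.\<close>

primrec divdiff :: "real \<Rightarrow> real \<Rightarrow> (nat \<Rightarrow> sym) \<Rightarrow> real \<Rightarrow> real \<Rightarrow> real \<Rightarrow> real \<Rightarrow> nat \<Rightarrow> real" where
  "divdiff du dv e u v u0 v0 0 = 0"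
| "divdiff du dv e u v u0 v0 (Suc n) =
     kneading_coeff e u v n * weight du dv (e (Suc n)) + divdiff du dv e u v u0 v0 n * weight u0 v0 (e (Suc n))"

lemma weight_linear: "weight u v s = u * weight 1 0 s + v * weight 0 1 s"
  by (cases s) auto

lemma kneading_coeff_diff:
  "kneading_coeff e u v n - kneading_coeff e u0 v0 n
    = (u - u0) * divdiff 1 0 e u v u0 v0 n + (v - v0) * divdiff 0 1 e u v u0 v0 n"
proof (induction n)
  case (Suc n)
  let ?k = "kneading_coeff e u v n" and ?l = "kneading_coeff e u0 v0 n"
    and ?w = "\<lambda>u v. weight u v (e (Suc n))"
  have "kneading_coeff e u v (Suc n) - kneading_coeff e u0 v0 (Suc n)
      = ?k * (?w u v - ?w u0 v0) + (?k - ?l) * ?w u0 v0"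
    by (simp add: algebra_simps)
  also have "?w u v - ?w u0 v0 = (u - u0) * ?w 1 0 + (v - v0) * ?w 0 1"
    using weight_linear[of u v "e (Suc n)"] weight_linear[of u0 v0 "e (Suc n)"]
    by (simp only: algebra_simps)
  finally show ?case unfolding Suc by (simp add: algebra_simps)
qed simp

text \<open>Euler's identity: coefficient \<open>n\<close> is zero or a monomial of degree
  \<open>n\<close> in \<open>u\<close> and \<open>v\<close>.\<close>

lemma divdiff_diagonal:
  "u * divdiff 1 0 e u v u v n + v * divdiff 0 1 e u v u v n = real n * kneading_coeff e u v n"
proof (induction n)
  case (Suc n)
  let ?k = "kneading_coeff e u v n" and ?w = "\<lambda>u v. weight u v (e (Suc n))"
  have "u * divdiff 1 0 e u v u v (Suc n) + v * divdiff 0 1 e u v u v (Suc n)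
      = ?k * (u * ?w 1 0 + v * ?w 0 1)
        + (u * divdiff 1 0 e u v u v n + v * divdiff 0 1 e u v u v n) * ?w u v"
    by (simp add: algebra_simps)
  also have "u * ?w 1 0 + v * ?w 0 1 = ?w u v" by (rule weight_linear[symmetric])
  finally show ?case unfolding Suc by (simp add: algebra_simps)
qed simp

lemma abs_weight_le: "\<bar>u\<bar> \<le> q \<Longrightarrow> \<bar>v\<bar> \<le> q \<Longrightarrow> \<bar>weight u v s\<bar> \<le> q"
  by (cases s) auto

lemma abs_kneading_coeff_le:
  assumes "\<bar>u\<bar> \<le> q" "\<bar>v\<bar> \<le> q"
  shows "\<bar>kneading_coeff e u v n\<bar> \<le> q ^ n"
proof (induction n)
  case (Suc n)
  have "0 \<le> q" using assms by linarith
  then have "\<bar>kneading_coeff e u v n\<bar> * \<bar>weight u v (e (Suc n))\<bar> \<le> q ^ n * q"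
    using Suc abs_weight_le[OF assms] by (intro mult_mono) auto
  then show ?case by (simp add: abs_mult mult.commute)
qed simp

text \<open>There are \<open>n\<close> summands with \<open>n - 1\<close> undifferentiated factors
  each; at \<open>n = 0\<close> the truncated exponent is harmless because of the factor
  \<open>real n\<close>.\<close>

lemma abs_divdiff_le:
  assumes "\<bar>u\<bar> \<le> q" "\<bar>v\<bar> \<le> q" "\<bar>u0\<bar> \<le> q" "\<bar>v0\<bar> \<le> q" "\<bar>du\<bar> \<le> 1" "\<bar>dv\<bar> \<le> 1"
  shows "\<bar>divdiff du dv e u v u0 v0 n\<bar> \<le> real n * q ^ (n - 1)"
proof (induction n)
  case (Suc n)
  have q: "0 \<le> q" using assms by linarith
  have "\<bar>divdiff du dv e u v u0 v0 (Suc n)\<bar>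
    \<le> \<bar>kneading_coeff e u v n\<bar> * \<bar>weight du dv (e (Suc n))\<bar> + \<bar>divdiff du dv e u v u0 v0 n\<bar> * \<bar>weight u0 v0 (e (Suc n))\<bar>"
    by (simp add: abs_mult[symmetric])
  also have "\<dots> \<le> q ^ n * 1 + (real n * q ^ (n - 1)) * q"
    using assms q Suc by (intro add_mono mult_mono abs_kneading_coeff_le abs_weight_le) auto
  also have "\<dots> = real (Suc n) * q ^ (Suc n - 1)"
    by (cases n) (simp_all add: algebra_simps)
  finally show ?case .
qed simp

lemma summable_divdiff_bound:
  assumes "0 \<le> q" "q < 1" shows "summable (\<lambda>n. real n * q ^ (n - 1))"
proof -
  have "summable (\<lambda>n. real (Suc n) * q ^ (Suc n - 1))"
    using geometric_deriv_sums[of q] assms by (auto intro: sums_summable)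
  then show ?thesis by (subst (asm) summable_Suc_iff)
qed

text \<open>Dominated convergence again. Constant \<open>U0\<close> and \<open>V0\<close> serve the
  difference quotient, while \<open>U0 = U\<close> and \<open>V0 = V\<close> serve continuity of the
  derivative.\<close>

lemma divdiff_tendsto:
  assumes lim: "(U \<longlongrightarrow> u) F" "(V \<longlongrightarrow> v) F" "(U0 \<longlongrightarrow> u0) F" "(V0 \<longlongrightarrow> v0) F"
    and less: "\<bar>u\<bar> < 1" "\<bar>v\<bar> < 1" "\<bar>u0\<bar> < 1" "\<bar>v0\<bar> < 1" and d: "\<bar>du\<bar> \<le> 1" "\<bar>dv\<bar> \<le> 1" and F: "F \<noteq> bot"
  shows "((\<lambda>z. \<Sum>n. divdiff du dv e (U z) (V z) (U0 z) (V0 z) n) \<longlongrightarrow> (\<Sum>n. divdiff du dv e u v u0 v0 n)) F"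
proof -
  \<comment> \<open>Room above the limits makes one geometric majorant valid eventually along
    \<open>F\<close>.\<close>
  obtain q where q: "Max {\<bar>u\<bar>, \<bar>v\<bar>, \<bar>u0\<bar>, \<bar>v0\<bar>} < q" "q < 1"
    using dense[of "Max {\<bar>u\<bar>, \<bar>v\<bar>, \<bar>u0\<bar>, \<bar>v0\<bar>}" 1] less by auto
  then have less_q: "\<bar>u\<bar> < q" "\<bar>v\<bar> < q" "\<bar>u0\<bar> < q" "\<bar>v0\<bar> < q" by auto
  have "eventually (\<lambda>z. \<bar>U z\<bar> < q \<and> \<bar>V z\<bar> < q \<and> \<bar>U0 z\<bar> < q \<and> \<bar>V0 z\<bar> < q) F"
    using lim[THEN tendsto_rabs, THEN order_tendstoD(2)] less_q by (intro eventually_conj) auto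
  then have ev: "eventually (\<lambda>z. \<forall>n. norm (divdiff du dv e (U z) (V z) (U0 z) (V0 z) n) \<le> real n * q ^ (n - 1)) F"
  proof eventually_elim
    case (elim z)
    then have "\<bar>divdiff du dv e (U z) (V z) (U0 z) (V0 z) n\<bar> \<le> real n * q ^ (n - 1)" for n
      using d by (intro abs_divdiff_le) auto
    then show ?case by simp
  qed
  have coeff_lim: "((\<lambda>z. kneading_coeff e (U z) (V z) n) \<longlongrightarrow> kneading_coeff e u v n) F" for n
  proof -
    have "((\<lambda>z. weight (U z) (V z) s) \<longlongrightarrow> weight u v s) F" for s
      using lim by (cases s) (auto intro: tendsto_intros)
    then show ?thesis by (induction n) (auto intro: tendsto_mult)
  qed
  show ?thesis
  proof (rule tannerys_theorem[THEN conjunct2, THEN conjunct2])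
    show "((\<lambda>z. divdiff du dv e (U z) (V z) (U0 z) (V0 z) n) \<longlongrightarrow> divdiff du dv e u v u0 v0 n) F" for n
    proof (induction n)
      case (Suc n)
      have "((\<lambda>z. weight (U0 z) (V0 z) s) \<longlongrightarrow> weight u0 v0 s) F" for s
        using lim by (cases s) (auto intro: tendsto_intros)
      then show ?case using Suc coeff_lim by (auto intro!: tendsto_intros)
    qed simp
    show "summable (\<lambda>n. real n * q ^ (n - 1))"
      using less_q(1) q(2) by (intro summable_divdiff_bound) auto
    show "eventually (\<lambda>(n, z). norm (divdiff du dv e (U z) (V z) (U0 z) (V0 z) n) \<le> real n * q ^ (n - 1)) (sequentially \<times>\<^sub>F F)"
      unfolding eventually_prod_filter
    proof (intro exI conjI)
      show "eventually (\<lambda>_. True) sequentially" by simp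
    qed (use ev in auto)
  qed (rule F)
qed

lemma summable_divdiff:
  assumes "\<bar>u\<bar> < 1" "\<bar>v\<bar> < 1" "\<bar>u0\<bar> < 1" "\<bar>v0\<bar> < 1" "\<bar>du\<bar> \<le> 1" "\<bar>dv\<bar> \<le> 1"
  shows "summable (divdiff du dv e u v u0 v0)"
proof -
  define q where "q = Max {\<bar>u\<bar>, \<bar>v\<bar>, \<bar>u0\<bar>, \<bar>v0\<bar>}"
  have q: "0 \<le> q" "q < 1" "\<bar>u\<bar> \<le> q" "\<bar>v\<bar> \<le> q" "\<bar>u0\<bar> \<le> q" "\<bar>v0\<bar> \<le> q"
    using assms by (auto simp: q_def le_max_iff_disj)
  show ?thesis
    by (rule summable_comparison_test'[OF summable_divdiff_bound[OF q(1,2)], of 0])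
       (use q assms abs_divdiff_le in simp)
qed


section \<open>Differentiation along an isentrope\<close>

text \<open>Subtracting the kneading equations at \<alpha> and \<gamma> and expanding by divided
  differences gives an exact formula for the difference quotient of \<open>\<Psi>\<close>.
  Continuity of \<open>\<Psi>\<close> gives its limit, since the limiting denominator is the nonzero
  first moment.\<close>

lemma isentrope_C1:
  fixes M :: kseq and a1 a2 :: real and \<Psi> :: "real \<Rightarrow> real"
  assumes cont: "continuous_on {a1<..<a2} \<Psi>"
    and U: "\<And>\<alpha>. \<alpha> \<in> {a1<..<a2} \<Longrightarrow> (\<alpha>, \<Psi> \<alpha>) \<in> U_region"
    and M: "\<And>\<alpha>. \<alpha> \<in> {a1<..<a2} \<Longrightarrow> kneading \<alpha> (\<Psi> \<alpha>) = M"
  shows "\<exists>D. (\<forall>\<alpha>\<in>{a1<..<a2}. (\<Psi> has_real_derivative D \<alpha>) (at \<alpha>)) \<and> continuous_on {a1<..<a2} D"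
proof -
  let ?I = "{a1<..<a2}"
  \<comment> \<open>The midpoint is merely a reference parameter: all parameters on the isentrope
    have the same coefficients as functions of \<open>u\<close> and \<open>v\<close>.\<close>
  define e where "e = ext_kneading ((a1 + a2) / 2) (\<Psi> ((a1 + a2) / 2))"
  define p r where "p \<alpha> = \<alpha> / \<Psi> \<alpha>" and "r \<alpha> = (1 - \<alpha>) / \<Psi> \<alpha>" for \<alpha>
  define G H where "G \<alpha> \<gamma> = (\<Sum>n. divdiff 1 0 e (p \<alpha>) (r \<alpha>) (p \<gamma>) (r \<gamma>) n)"
    and "H \<alpha> \<gamma> = (\<Sum>n. divdiff 0 1 e (p \<alpha>) (r \<alpha>) (p \<gamma>) (r \<gamma>) n)" for \<alpha> \<gamma>
  \<comment> \<open>Obtained by solving \<open>p' * G + r' * H = 0\<close> for the derivative of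
    \<open>\<Psi>\<close>, with \<open>p' = (1 - p * \<Psi>') / \<Psi>\<close> and
    \<open>r' = (- 1 - r * \<Psi>') / \<Psi>\<close>.\<close>
  define D where "D \<alpha> = (G \<alpha> \<alpha> - H \<alpha> \<alpha>) / (p \<alpha> * G \<alpha> \<alpha> + r \<alpha> * H \<alpha> \<alpha>)" for \<alpha>
  have coeff_eq: "kneading_coeff (ext_kneading \<alpha> (\<Psi> \<alpha>)) = kneading_coeff e" if "\<alpha> \<in> ?I" for \<alpha>
  proof (intro ext)
    show "kneading_coeff (ext_kneading \<alpha> (\<Psi> \<alpha>)) u v n = kneading_coeff e u v n" for u v n
      unfolding e_def using that by (intro kneading_eq_imp_kneading_coeff_eq) (auto simp: M)
  qed
  have orbit: "tent_orbit (p \<alpha>) (r \<alpha>) (1 / (\<Psi> \<alpha> - \<alpha>))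
    (\<lambda>n. ((skew_tent \<alpha> (\<Psi> \<alpha>) ^^ Suc n) \<alpha> - \<alpha>) / (\<Psi> \<alpha> - \<alpha>)) (kneading_coeff e (p \<alpha>) (r \<alpha>))"
    if "\<alpha> \<in> ?I" for \<alpha>
    using tent_orbit_skew_tent[OF U[OF that]] coeff_eq[OF that] by (simp add: p_def r_def)
  have pr: "\<bar>p \<alpha>\<bar> < 1" "\<bar>r \<alpha>\<bar> < 1" if "\<alpha> \<in> ?I" for \<alpha>
    using tent_orbit.u[OF orbit[OF that]] tent_orbit.v[OF orbit[OF that]] by auto
  have pos: "\<Psi> \<alpha> > 0" if "\<alpha> \<in> ?I" for \<alpha> using U[OF that] by (auto simp: U_region_def)
  have zero: "(p \<alpha> - p \<gamma>) * G \<alpha> \<gamma> + (r \<alpha> - r \<gamma>) * H \<alpha> \<gamma> = 0" if "\<alpha> \<in> ?I" "\<gamma> \<in> ?I" for \<alpha> \<gamma>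
  proof -
    have "(\<lambda>n. (p \<alpha> - p \<gamma>) * divdiff 1 0 e (p \<alpha>) (r \<alpha>) (p \<gamma>) (r \<gamma>) n
        + (r \<alpha> - r \<gamma>) * divdiff 0 1 e (p \<alpha>) (r \<alpha>) (p \<gamma>) (r \<gamma>) n)
      sums ((p \<alpha> - p \<gamma>) * G \<alpha> \<gamma> + (r \<alpha> - r \<gamma>) * H \<alpha> \<gamma>)"
      unfolding G_def H_def using pr that
      by (intro sums_add sums_mult summable_sums summable_divdiff) auto
    moreover have "(\<lambda>n. kneading_coeff e (p \<alpha>) (r \<alpha>) n - kneading_coeff e (p \<gamma>) (r \<gamma>) n) sums (0 - 0)"
      using orbit that by (intro sums_diff tent_orbit.a_sums_0)
    ultimately show ?thesis by (simp add: kneading_coeff_diff sums_unique2)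
  qed
  have nondegenerate: "p \<alpha> * G \<alpha> \<alpha> + r \<alpha> * H \<alpha> \<alpha> < 0" if "\<alpha> \<in> ?I" for \<alpha>
  proof -
    have "(\<lambda>n. p \<alpha> * divdiff 1 0 e (p \<alpha>) (r \<alpha>) (p \<alpha>) (r \<alpha>) n
        + r \<alpha> * divdiff 0 1 e (p \<alpha>) (r \<alpha>) (p \<alpha>) (r \<alpha>) n)
      sums (p \<alpha> * G \<alpha> \<alpha> + r \<alpha> * H \<alpha> \<alpha>)"
      unfolding G_def H_def using pr that
      by (intro sums_add sums_mult summable_sums summable_divdiff) auto
    then have "(\<Sum>n. real n * kneading_coeff e (p \<alpha>) (r \<alpha>) n) = p \<alpha> * G \<alpha> \<alpha> + r \<alpha> * H \<alpha> \<alpha>"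
      unfolding divdiff_diagonal by (rule sums_unique[symmetric])
    then show ?thesis using tent_orbit.suminf_index_a_neg[OF orbit[OF that]] by simp
  qed
  have lim: "(\<Psi> \<longlongrightarrow> \<Psi> \<gamma>) (at \<gamma>)" "(p \<longlongrightarrow> p \<gamma>) (at \<gamma>)" "(r \<longlongrightarrow> r \<gamma>) (at \<gamma>)" if "\<gamma> \<in> ?I" for \<gamma>
  proof -
    show *: "(\<Psi> \<longlongrightarrow> \<Psi> \<gamma>) (at \<gamma>)"
      using cont that by (simp add: continuous_on_eq_continuous_at isCont_def)
    have "\<Psi> \<gamma> \<noteq> 0" using pos[OF that] by simp
    then show "(p \<longlongrightarrow> p \<gamma>) (at \<gamma>)" "(r \<longlongrightarrow> r \<gamma>) (at \<gamma>)"
      unfolding p_def r_def by (intro tendsto_intros *; assumption)+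
  qed
  have D_lim: "(D \<longlongrightarrow> D \<gamma>) (at \<gamma>)" if "\<gamma> \<in> ?I" for \<gamma>
  proof -
    have "((\<lambda>\<alpha>. G \<alpha> \<alpha>) \<longlongrightarrow> G \<gamma> \<gamma>) (at \<gamma>)" "((\<lambda>\<alpha>. H \<alpha> \<alpha>) \<longlongrightarrow> H \<gamma> \<gamma>) (at \<gamma>)"
      unfolding G_def H_def using lim[OF that] pr[OF that] by (intro divdiff_tendsto; simp)+
    then show ?thesis
      unfolding D_def using lim[OF that] nondegenerate[OF that] by (intro tendsto_intros) auto
  qed
  moreover have "(\<Psi> has_real_derivative D \<gamma>) (at \<gamma>)" if \<gamma>: "\<gamma> \<in> ?I" for \<gamma>
  proof -
    have lim_GH: "((\<lambda>\<alpha>. G \<alpha> \<gamma>) \<longlongrightarrow> G \<gamma> \<gamma>) (at \<gamma>)" "((\<lambda>\<alpha>. H \<alpha> \<gamma>) \<longlongrightarrow> H \<gamma> \<gamma>) (at \<gamma>)"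
      unfolding G_def H_def using lim[OF \<gamma>] pr[OF \<gamma>] by (intro divdiff_tendsto; simp)+
    then have lim_den: "((\<lambda>\<alpha>. p \<gamma> * G \<alpha> \<gamma> + r \<gamma> * H \<alpha> \<gamma>) \<longlongrightarrow> p \<gamma> * G \<gamma> \<gamma> + r \<gamma> * H \<gamma> \<gamma>) (at \<gamma>)"
      by (intro tendsto_intros)
    with lim_GH have "((\<lambda>\<alpha>. (G \<alpha> \<gamma> - H \<alpha> \<gamma>) / (p \<gamma> * G \<alpha> \<gamma> + r \<gamma> * H \<alpha> \<gamma>)) \<longlongrightarrow> D \<gamma>) (at \<gamma>)"
      unfolding D_def using nondegenerate[OF \<gamma>] by (intro tendsto_intros) auto
    moreover have "eventually (\<lambda>\<alpha>. (G \<alpha> \<gamma> - H \<alpha> \<gamma>) / (p \<gamma> * G \<alpha> \<gamma> + r \<gamma> * H \<alpha> \<gamma>)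
        = (\<Psi> \<alpha> - \<Psi> \<gamma>) / (\<alpha> - \<gamma>)) (at \<gamma>)"
    proof -
      have "eventually (\<lambda>\<alpha>. p \<gamma> * G \<alpha> \<gamma> + r \<gamma> * H \<alpha> \<gamma> < 0) (at \<gamma>)"
        using lim_den nondegenerate[OF \<gamma>] by (rule order_tendstoD(2))
      moreover have "eventually (\<lambda>\<alpha>. \<alpha> \<in> ?I) (at \<gamma>)"
        using \<gamma> by (intro eventually_at_in_open') auto
      moreover have "eventually (\<lambda>\<alpha>. \<alpha> \<noteq> \<gamma>) (at \<gamma>)" by (simp add: eventually_at_filter)
      ultimately show ?thesis
      proof eventually_elim
        case (elim \<alpha>)
        have *: "\<Psi> \<alpha> > 0" "\<Psi> \<gamma> > 0" using pos elim(2) \<gamma> by auto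
        \<comment> \<open>Multiplying by \<open>\<Psi> \<alpha>\<close> makes the increments of
          \<open>p\<close> and \<open>r\<close> affine in those of \<alpha> and
          \<open>\<Psi>\<close>, with coefficients depending on \<gamma> only.\<close>
        have p: "(p \<alpha> - p \<gamma>) * \<Psi> \<alpha> = (\<alpha> - \<gamma>) - p \<gamma> * (\<Psi> \<alpha> - \<Psi> \<gamma>)"
          and r: "(r \<alpha> - r \<gamma>) * \<Psi> \<alpha> = - (\<alpha> - \<gamma>) - r \<gamma> * (\<Psi> \<alpha> - \<Psi> \<gamma>)"
          using * by (auto simp: p_def r_def field_simps)
        have "0 = ((p \<alpha> - p \<gamma>) * G \<alpha> \<gamma> + (r \<alpha> - r \<gamma>) * H \<alpha> \<gamma>) * \<Psi> \<alpha>"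
          using zero[OF elim(2) \<gamma>] by simp
        also have "\<dots> = ((p \<alpha> - p \<gamma>) * \<Psi> \<alpha>) * G \<alpha> \<gamma> + ((r \<alpha> - r \<gamma>) * \<Psi> \<alpha>) * H \<alpha> \<gamma>"
          by (simp add: algebra_simps)
        also have "\<dots> = (\<alpha> - \<gamma>) * (G \<alpha> \<gamma> - H \<alpha> \<gamma>)
            - (\<Psi> \<alpha> - \<Psi> \<gamma>) * (p \<gamma> * G \<alpha> \<gamma> + r \<gamma> * H \<alpha> \<gamma>)"
          unfolding p r by (simp add: algebra_simps)
        finally have "(G \<alpha> \<gamma> - H \<alpha> \<gamma>) * (\<alpha> - \<gamma>) = (\<Psi> \<alpha> - \<Psi> \<gamma>) * (p \<gamma> * G \<alpha> \<gamma> + r \<gamma> * H \<alpha> \<gamma>)"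
          by (simp add: mult.commute)
        then show ?case using elim(1,3) by (subst frac_eq_eq) auto
      qed
    qed
    ultimately show ?thesis
      unfolding has_field_derivative_iff by (rule Lim_transform_eventually)
  qed
  ultimately show ?thesis
    by (intro exI[of _ D]) (auto simp: continuous_on_eq_continuous_at isCont_def)
qed

theorem theorem1p1:
  fixes M :: kseq and a1 a2 :: real and \<Psi> :: "real \<Rightarrow> real"
  assumes "M \<in> kneading_set"
    and "a1 < a2"
    and "continuous_on {a1<..<a2} \<Psi>"
    and "\<And>\<alpha>. \<alpha> \<in> {a1<..<a2} \<Longrightarrow> (\<alpha>, \<Psi> \<alpha>) \<in> U_region"
    and "\<And>\<alpha> \<beta>. (\<alpha>, \<beta>) \<in> U_region \<Longrightarrow>
            (kneading \<alpha> \<beta> = M \<longleftrightarrow> (\<alpha> \<in> {a1<..<a2} \<and> \<beta> = \<Psi> \<alpha>))"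
  shows "(\<forall>x\<in>{a1<..<a2}. \<Psi> differentiable (at x))
         \<and> continuous_on {a1<..<a2} (deriv \<Psi>)"
proof -
  obtain D where D: "\<And>\<alpha>. \<alpha> \<in> {a1<..<a2} \<Longrightarrow> (\<Psi> has_real_derivative D \<alpha>) (at \<alpha>)"
    and cont_D: "continuous_on {a1<..<a2} D"
    using isentrope_C1[of a1 a2 \<Psi> M] assms(3-5) by blast
  have "continuous_on {a1<..<a2} (deriv \<Psi>) \<longleftrightarrow> continuous_on {a1<..<a2} D"
    by (rule continuous_on_cong) (simp_all add: DERIV_imp_deriv D)
  moreover have "\<Psi> differentiable (at \<alpha>)" if "\<alpha> \<in> {a1<..<a2}" for \<alpha>
    using D[OF that] unfolding has_field_derivative_def by (rule differentiableI)
  ultimately show ?thesis using cont_D by simp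
qed

end
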